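(* Let $\varphi$ be a parabolic linear-fractional self-map of $\mathbb{D}$ with fixed point $\zeta\in\partial\mathbb{D}$. Then $\varphi$ can be written as $\varphi(z)=a_0+\frac{a_1z}{1-a_0z}$ for some $a_0\in\mathbb{D}$ and $a_1\in\mathbb{C}$ if and only if $\zeta=1$ or $\zeta=-1$.
   Context: $\mathbb{D}$ is the open unit disk. A linear-fractional self-map of $\mathbb{D}$ is called parabolic if it has exactly one fixed point in the Riemann sphere and this fixed point $\zeta$ lies on $\partial\mathbb{D}$. Automorphisms are allowed. *)

theory Defs
  imports "HOL-Analysis.Analysis"
begin

abbreviation unit_disk :: "complex set" where
  "unit_disk \<equiv> ball 0 1"

text \<open>The Riemann sphere is the one-point compactification of the complex plane; as for
  \<^const>\<open>Alexandroff_compactification\<close>, its points form an option type with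
  \<^term>\<open>None\<close> as the point at infinity.\<close>

type_synonym riemann_sphere = "complex option"

fun lin_frac :: "complex \<Rightarrow> complex \<Rightarrow> complex \<Rightarrow> complex \<Rightarrow> riemann_sphere \<Rightarrow> riemann_sphere" where
  "lin_frac a b c d None = (if c = 0 then None else Some (a / c))"
| "lin_frac a b c d (Some z) =
     (if c * z + d = 0 then None else Some ((a * z + b) / (c * z + d)))"

definition linear_fractional :: "(riemann_sphere \<Rightarrow> riemann_sphere) \<Rightarrow> bool" where
  "linear_fractional F \<longleftrightarrow> (\<exists>a b c d. a * d - b * c \<noteq> 0 \<and> F = lin_frac a b c d)"

text \<open>Self-maps of the disk are functions on \<^typ>\<open>complex\<close> of which only the values on the disk
  matter. The second condition forces the pole of the extension to lie outside the disk.
  A linear-fractional extension of a given map is unique, being determined by its values at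
  three points.\<close>

definition linear_fractional_extension ::
    "(complex \<Rightarrow> complex) \<Rightarrow> (riemann_sphere \<Rightarrow> riemann_sphere) \<Rightarrow> bool" where
  "linear_fractional_extension \<phi> F \<longleftrightarrow>
     linear_fractional F \<and> (\<forall>z\<in>unit_disk. F (Some z) = Some (\<phi> z))"

definition linear_fractional_self_map :: "(complex \<Rightarrow> complex) \<Rightarrow> bool" where
  "linear_fractional_self_map \<phi> \<longleftrightarrow>
     \<phi> ` unit_disk \<subseteq> unit_disk \<and> (\<exists>F. linear_fractional_extension \<phi> F)"

definition parabolic_self_map :: "(complex \<Rightarrow> complex) \<Rightarrow> complex \<Rightarrow> bool" where
  "parabolic_self_map \<phi> \<zeta> \<longleftrightarrow>
     linear_fractional_self_map \<phi> \<and>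
     (\<exists>F. linear_fractional_extension \<phi> F \<and> {w. F w = w} = {Some \<zeta>}) \<and>
     \<zeta> \<in> frontier unit_disk"

end

theory Submission
  imports Defs
begin

text \<open>Since \<open>\<infinity>\<close> is not fixed and the fixed-point equation is a quadratic with the double root \<open>\<zeta>\<close>,
  a parabolic map is \<open>\<phi> z = ((1 + 2k\<zeta>) z - k\<zeta>\<^sup>2) / (1 + kz)\<close> for some \<open>k \<noteq> 0\<close>. Comparing this
  with \<open>a0 + a1 z / (1 - a0 z)\<close>, where \<open>a0 = \<phi> 0\<close>, forces the two denominators to agree,
  that is \<open>k = k\<zeta>\<^sup>2\<close>.\<close>

text \<open>Away from the pole, clear the denominator. At the pole the value is \<open>None\<close>,
  and the quadratic, which is \<open>z * (c * z + d) - (a * z + b)\<close>, could vanish only if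
  numerator and denominator shared the root \<open>z\<close>; that would make the determinant
  zero.\<close>

lemma lin_frac_fixed_point_iff:
  assumes "a * d - b * c \<noteq> 0"
  shows "lin_frac a b c d (Some z) = Some z \<longleftrightarrow> c * z\<^sup>2 + (d - a) * z - b = 0"
proof (cases "c * z + d = 0")
  case True
  then have d: "d = - c * z"
    by (simp add: add_eq_0_iff)
  have "c * z\<^sup>2 + (d - a) * z - b \<noteq> 0"
  proof
    assume "c * z\<^sup>2 + (d - a) * z - b = 0"
    then have "b = - a * z"
      by (simp add: d power2_eq_square algebra_simps)
    then show False
      using assms by (simp add: d)
  qed
  with True show ?thesis by simp
next
  case False
  then show ?thesis
    by (auto simp: divide_simps power2_eq_square algebra_simps)
qed

text \<open>As \<open>None\<close> is not fixed, the fixed-point equation is truly quadratic. Its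
  only root is \<zeta>, so it is a multiple of the square of \<open>z - \<zeta>\<close>, and
  coefficients can be compared.\<close>

lemma lin_frac_unique_fixed_point:
  assumes det: "a * d - b * c \<noteq> 0"
    and fp: "{w. lin_frac a b c d w = w} = {Some \<zeta>}"
  shows "c \<noteq> 0" "a = d + 2 * c * \<zeta>" "b = - c * \<zeta>\<^sup>2"
proof -
  have fixed_iff: "lin_frac a b c d w = w \<longleftrightarrow> w = Some \<zeta>" for w
  proof -
    have "lin_frac a b c d w = w \<longleftrightarrow> w \<in> {w. lin_frac a b c d w = w}"
      by (rule mem_Collect_eq[symmetric])
    also have "\<dots> \<longleftrightarrow> w = Some \<zeta>"
      unfolding fp by (rule singleton_iff)
    finally show ?thesis .
  qed
  show c: "c \<noteq> 0"
    using fixed_iff[of None] by (simp split: if_splits)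
  have root_iff: "c * z\<^sup>2 + (d - a) * z - b = 0 \<longleftrightarrow> z = \<zeta>" for z
    unfolding lin_frac_fixed_point_iff[OF det, symmetric] fixed_iff by (rule option.inject)
  have root: "c * \<zeta>\<^sup>2 + (d - a) * \<zeta> - b = 0"
    using root_iff by blast
  \<comment> \<open>By Vieta, this is the second root.\<close>
  define w where "w = (a - d) / c - \<zeta>"
  have cw: "c * w = a - d - c * \<zeta>"
    using c by (simp add: w_def field_simps)
  have "c * w\<^sup>2 + (d - a) * w - b = 0"
    using cw root by algebra
  then have "w = \<zeta>"
    using root_iff by simp
  with cw show a: "a = d + 2 * c * \<zeta>"
    by (simp add: algebra_simps)
  show "b = - c * \<zeta>\<^sup>2"
    using root by (simp add: a power2_eq_square algebra_simps)
qed

lemma parabolic_normal_form: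
  assumes "parabolic_self_map \<phi> \<zeta>"
  obtains k where "k \<noteq> 0" "1 + k * \<zeta> \<noteq> 0" "\<And>z. z \<in> unit_disk \<Longrightarrow> 1 + k * z \<noteq> 0"
    "\<And>z. z \<in> unit_disk \<Longrightarrow> \<phi> z = ((1 + 2 * k * \<zeta>) * z - k * \<zeta>\<^sup>2) / (1 + k * z)"
proof -
  obtain F where F: "linear_fractional_extension \<phi> F" "{w. F w = w} = {Some \<zeta>}"
    using assms unfolding parabolic_self_map_def by blast
  then obtain a b c d where det: "a * d - b * c \<noteq> 0" and Fdef: "F = lin_frac a b c d"
    unfolding linear_fractional_extension_def linear_fractional_def by blast
  note coeffs = lin_frac_unique_fixed_point[OF det F(2)[unfolded Fdef]]
  have val: "c * z + d \<noteq> 0 \<and> \<phi> z = (a * z + b) / (c * z + d)" if "z \<in> unit_disk" for z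
  proof -
    have "lin_frac a b c d (Some z) = Some (\<phi> z)"
      using F(1) that unfolding linear_fractional_extension_def Fdef by blast
    then show ?thesis
      by (simp split: if_splits)
  qed
  have d: "d \<noteq> 0"
    using val[of 0] by simp
  \<comment> \<open>The double root makes the determinant a perfect square, so \<zeta> is not the
    pole.\<close>
  have "a * d - b * c = (d + c * \<zeta>)\<^sup>2"
    by (simp add: coeffs power2_eq_square algebra_simps)
  then have nz: "d + c * \<zeta> \<noteq> 0"
    using det by auto
  define k where "k = c / d"
  have c: "c = d * k"
    using d by (simp add: k_def)
  have den: "c * z + d = d * (1 + k * z)" for z
    by (simp add: c algebra_simps)
  have num: "a * z + b = d * ((1 + 2 * k * \<zeta>) * z - k * \<zeta>\<^sup>2)" for z
    unfolding coeffs(2,3) by (simp add: c algebra_simps)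
  show thesis
  proof
    show "k \<noteq> 0" using coeffs(1) c by auto
    show "1 + k * \<zeta> \<noteq> 0" using nz den[of \<zeta>] by (auto simp: add.commute)
    show "1 + k * z \<noteq> 0" if "z \<in> unit_disk" for z
      using val[OF that] den[of z] by auto
    show "\<phi> z = ((1 + 2 * k * \<zeta>) * z - k * \<zeta>\<^sup>2) / (1 + k * z)" if "z \<in> unit_disk" for z
      using val[OF that] d unfolding den num by simp
  qed
qed

lemma one_minus_mult_nonzero_disk:
  assumes "a \<in> unit_disk" "z \<in> unit_disk"
  shows "1 - a * z \<noteq> 0"
proof
  assume "1 - a * z = 0"
  then have "norm a * norm z = 1"
    by (metis eq_iff_diff_eq_0 norm_mult norm_one)
  moreover have "norm a * norm z < 1 * 1"
    using assms by (intro mult_strict_mono') auto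
  ultimately show False by simp
qed

theorem lemma3p2:
  fixes \<phi> :: "complex \<Rightarrow> complex" and \<zeta> :: complex
  assumes "parabolic_self_map \<phi> \<zeta>"
  shows "(\<exists>a0\<in>unit_disk. \<exists>a1::complex. \<forall>z\<in>unit_disk. \<phi> z = a0 + a1 * z / (1 - a0 * z))
           \<longleftrightarrow> \<zeta> = 1 \<or> \<zeta> = -1"
proof -
  obtain k where k: "k \<noteq> 0" "1 + k * \<zeta> \<noteq> 0"
    and den: "\<And>z. z \<in> unit_disk \<Longrightarrow> 1 + k * z \<noteq> 0"
    and \<phi>: "\<And>z. z \<in> unit_disk \<Longrightarrow> \<phi> z = ((1 + 2 * k * \<zeta>) * z - k * \<zeta>\<^sup>2) / (1 + k * z)"
    using parabolic_normal_form[OF assms] by metis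
  have \<phi>0: "\<phi> 0 = - k * \<zeta>\<^sup>2"
    using \<phi>[of 0] by simp
  show ?thesis
  proof
    assume "\<exists>a0\<in>unit_disk. \<exists>a1::complex. \<forall>z\<in>unit_disk. \<phi> z = a0 + a1 * z / (1 - a0 * z)"
    then obtain a0 a1 where a0: "a0 \<in> unit_disk"
      and eq: "\<And>z. z \<in> unit_disk \<Longrightarrow> \<phi> z = a0 + a1 * z / (1 - a0 * z)"
      by blast
    have a0_eq: "a0 = - k * \<zeta>\<^sup>2"
      using eq[of 0] \<phi>0 by simp
    define a where "a = 1 + 2 * k * \<zeta>"
    \<comment> \<open>Once the two formulas for \<open>\<phi> z\<close> are cross-multiplied,
      \<alpha> and \<beta> are the coefficients of \<open>z\<close> and \<open>z\<^sup>2\<close> in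
      the difference; the constant terms, both \<open>a0\<close>, cancel.\<close>
    define \<alpha> where "\<alpha> = a1 + a0 * k - a"
    define \<beta> where "\<beta> = (a1 - a0\<^sup>2) * k + a * a0"
    have quad: "\<alpha> * z + \<beta> * z\<^sup>2 = 0" if z: "z \<in> unit_disk" for z
    proof -
      note nz = den[OF z] one_minus_mult_nonzero_disk[OF a0 z]
      have "(a * z + a0) / (1 + k * z) = \<phi> z"
        by (simp add: \<phi>[OF z] a_def a0_eq)
      also have "\<dots> = (a0 * (1 - a0 * z) + a1 * z) / (1 - a0 * z)"
        unfolding eq[OF z] add_divide_distrib using nz(2) by simp
      finally have "(a * z + a0) / (1 + k * z) = (a0 * (1 - a0 * z) + a1 * z) / (1 - a0 * z)" .
      then have "(a * z + a0) * (1 - a0 * z) = (a0 * (1 - a0 * z) + a1 * z) * (1 + k * z)"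
        by (simp only: frac_eq_eq[OF nz])
      then show ?thesis
        unfolding \<alpha>_def \<beta>_def by algebra
    qed
    \<comment> \<open>Two nonzero points of the disk determine both coefficients.\<close>
    have "\<alpha> + \<beta> / 2 = 0" "\<alpha> - \<beta> / 2 = 0"
      using quad[of "1/2"] quad[of "-1/2"] by (auto simp: power2_eq_square field_simps)
    then have "\<alpha> = 0" "\<beta> = 0"
      by (auto simp: algebra_simps)
    \<comment> \<open>The combination \<open>\<beta> - k * \<alpha>\<close> eliminates
      \<open>a1\<close> and factors in this way.\<close>
    then have "(a0 + k) * (a - a0 * k) = 0"
      unfolding \<alpha>_def \<beta>_def by algebra
    \<comment> \<open>The second factor is the determinant of the normal form, hence
      nonzero.\<close>
    moreover have "a - a0 * k = (1 + k * \<zeta>)\<^sup>2"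
      unfolding a_def a0_eq by (simp add: power2_eq_square algebra_simps)
    ultimately have "a0 + k = 0"
      using k(2) by simp
    then have "k * (\<zeta>\<^sup>2 - 1) = 0"
      by (simp add: a0_eq algebra_simps)
    then show "\<zeta> = 1 \<or> \<zeta> = -1"
      using k(1) by (simp add: power2_eq_1_iff)
  next
    assume "\<zeta> = 1 \<or> \<zeta> = -1"
    then have "\<zeta>\<^sup>2 = 1" by auto
    show "\<exists>a0\<in>unit_disk. \<exists>a1::complex. \<forall>z\<in>unit_disk. \<phi> z = a0 + a1 * z / (1 - a0 * z)"
    proof (intro bexI exI ballI)
      \<comment> \<open>The witness for \<open>a0\<close> is forced to be \<open>\<phi> 0\<close>,
        which is \<open>- k\<close> here; it lies in the disk because \<phi> is a self-map.\<close>
      have "\<phi> 0 \<in> unit_disk"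
        using assms unfolding parabolic_self_map_def linear_fractional_self_map_def
        by (force simp: image_subset_iff)
      then show "- k \<in> unit_disk"
        by (simp add: \<phi>0 \<open>\<zeta>\<^sup>2 = 1\<close>)
      \<comment> \<open>The witness for \<open>a1\<close> is the derivative of \<phi> at 0.\<close>
      show "\<phi> z = - k + (1 + 2 * k * \<zeta> + k\<^sup>2) * z / (1 - - k * z)" if z: "z \<in> unit_disk" for z
        using den[OF z] by (simp add: \<phi>[OF z] \<open>\<zeta>\<^sup>2 = 1\<close> divide_simps)
          (simp add: power2_eq_square algebra_simps)
    qed
  qed
qed

end
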